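(* Let $\mathcal{A}$ be a unital Banach algebra and let $a\in\mathcal{A}$ be Moore-Penrose invertible with Moore-Penrose inverse $a^{\dagger}$. Then $aa^{\dagger}+a^{\dagger}a\in\mathcal{A}^{-1}$ if and only if all of the following hold: $aa^{\dagger}+a^{\dagger}a$ is regular, $(aa^{\dagger}+a^{\dagger}a)_{-1}(0)=0$, $a^{\dagger}a\mathcal{A}\cap aa^{\dagger}(1-a^{\dagger}a)\mathcal{A}=0$, and $a^{-1}(0)\cap(a^{\dagger})^{-1}(0)=0$.
   Context: $\mathcal{A}$ denotes a complex unital Banach algebra with unit $1$, and $\mathcal{A}^{-1}$ is its set of invertible elements. An element $c\in\mathcal{A}$ is hermitian if $\|\exp(itc)\|=1$ for all $t\in\mathbb{R}$. An element $a\in\mathcal{A}$ is Moore-Penrose invertible if there exists $x\in\mathcal{A}$ with $axa=a$, $xax=x$ and both $ax$ and $xa$ hermitian; such $x$ is unique, is called the Moore-Penrose inverse of $a$ and is denoted $a^{\dagger}$. An element $c\in\mathcal{A}$ is regular if there exists $b\in\mathcal{A}$ with $c=cbc$. For $c\in\mathcal{A}$: $c\mathcal{A}=\{cx: x\in\mathcal{A}\}$, $c^{-1}(0)=\{x\in\mathcal{A}: cx=0\}$, $c_{-1}(0)=\{x\in\mathcal{A}: xc=0\}$. The symbol $0$ also denotes the zero subspace. *)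

theory Defs
  imports "HOL-Analysis.Analysis"
begin

text \<open>The class \<open>{real_normed_algebra_1, banach}\<close> contains submultiplicativity of the norm,
  \<open>norm 1 = 1\<close> and completeness. What is added here is the complex scalar multiplication.
  Its restriction to the reals is the given one, so that \<open>exp\<close> has its library meaning.\<close>

class complex_banach_algebra_1 = real_normed_algebra_1 + banach +
  fixes scaleC :: "complex \<Rightarrow> 'a \<Rightarrow> 'a"  (infixr \<open>*\<^sub>C\<close> 75)
  assumes scaleC_add_right: "z *\<^sub>C (x + y) = z *\<^sub>C x + z *\<^sub>C y"
    and scaleC_add_left: "(z + w) *\<^sub>C x = z *\<^sub>C x + w *\<^sub>C x"
    and scaleC_scaleC: "z *\<^sub>C w *\<^sub>C x = (z * w) *\<^sub>C x"
    and scaleC_one: "1 *\<^sub>C x = x"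
    and scaleR_scaleC: "r *\<^sub>R x = complex_of_real r *\<^sub>C x"
    and mult_scaleC_left: "(z *\<^sub>C x) * y = z *\<^sub>C (x * y)"
    and mult_scaleC_right: "x * (z *\<^sub>C y) = z *\<^sub>C (x * y)"
    and norm_scaleC: "norm (z *\<^sub>C x) = cmod z * norm x"

instantiation complex :: complex_banach_algebra_1
begin

definition scaleC_complex :: "complex \<Rightarrow> complex \<Rightarrow> complex" where
  "scaleC_complex z x = z * x"

instance
  by standard (auto simp: scaleC_complex_def algebra_simps norm_mult scaleR_conv_of_real)

end

definition invertible_elements :: "'a::complex_banach_algebra_1 set" where
  "invertible_elements = {c. \<exists>b. c * b = 1 \<and> b * c = 1}"

definition hermitian :: "'a::complex_banach_algebra_1 \<Rightarrow> bool" where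
  "hermitian c \<longleftrightarrow> (\<forall>t::real. norm (exp ((\<i> * complex_of_real t) *\<^sub>C c)) = 1)"

definition is_mp_inverse :: "'a::complex_banach_algebra_1 \<Rightarrow> 'a \<Rightarrow> bool" where
  "is_mp_inverse a x \<longleftrightarrow>
     a * x * a = a \<and> x * a * x = x \<and> hermitian (a * x) \<and> hermitian (x * a)"

definition mp_invertible :: "'a::complex_banach_algebra_1 \<Rightarrow> bool" where
  "mp_invertible a \<longleftrightarrow> (\<exists>x. is_mp_inverse a x)"

text \<open>Meaningful only for \<open>mp_invertible a\<close>; see \<open>mp_inverse_eq\<close> below for well-definedness.\<close>

definition mp_inverse :: "'a::complex_banach_algebra_1 \<Rightarrow> 'a"  (\<open>_\<^sup>\<dagger>\<close> [1000] 999) where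
  "a\<^sup>\<dagger> = (THE x. is_mp_inverse a x)"

definition regular :: "'a::complex_banach_algebra_1 \<Rightarrow> bool" where
  "regular c \<longleftrightarrow> (\<exists>b. c = c * b * c)"

definition right_ideal :: "'a::complex_banach_algebra_1 \<Rightarrow> 'a set" where
  "right_ideal c = {c * x |x. True}"

definition right_annihilator :: "'a::complex_banach_algebra_1 \<Rightarrow> 'a set" where
  "right_annihilator c = {x. c * x = 0}"

definition left_annihilator :: "'a::complex_banach_algebra_1 \<Rightarrow> 'a set" where
  "left_annihilator c = {x. x * c = 0}"


text \<open>Uniqueness of the Moore-Penrose inverse.\<close>

lemma scaleC_scaleR_left:
  "(r *\<^sub>R z) *\<^sub>C (x::'a::complex_banach_algebra_1) = r *\<^sub>R (z *\<^sub>C x)"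
  unfolding scaleR_conv_of_real[of r z] scaleR_scaleC[of r "z *\<^sub>C x"] scaleC_scaleC ..

lemma bounded_linear_scaleC_left:
  "bounded_linear (\<lambda>z. z *\<^sub>C (x::'a::complex_banach_algebra_1))"
  by (rule bounded_linear_intro[where K = "norm x"])
     (auto simp: scaleC_add_left scaleC_scaleR_left norm_scaleC)

lemma hermitian_idempotent_norm:
  fixes p :: "'a::complex_banach_algebra_1"
  assumes "hermitian p" and idem: "p * p = p"
  shows "norm (1 - 2 * p) = 1"
proof -
  define z where "z = \<i> * complex_of_real pi"
  have pow: "(z *\<^sub>C p) ^ Suc n = (z ^ Suc n) *\<^sub>C p" for n
    by (induction n) (simp_all add: mult_scaleC_left mult_scaleC_right scaleC_scaleC idem mult_ac)
  have sumsC: "(\<lambda>n. (z ^ n /\<^sub>R fact n) *\<^sub>C p) sums (exp z *\<^sub>C p)"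
    by (rule bounded_linear.sums[OF bounded_linear_scaleC_left exp_converges])
  have "(\<lambda>n. (z ^ n /\<^sub>R fact n) *\<^sub>C p + (if n = 0 then 1 - p else 0)) sums (exp z *\<^sub>C p + (1 - p))"
    by (intro sums_add[OF sumsC] sums_single[of 0 "\<lambda>_. 1 - p"])
  moreover have "(z ^ n /\<^sub>R fact n) *\<^sub>C p + (if n = 0 then 1 - p else 0) = (z *\<^sub>C p) ^ n /\<^sub>R fact n" for n
    using pow[of "n - 1"]
    by (cases n) (simp_all add: scaleC_one scaleC_scaleR_left)
  ultimately have "(\<lambda>n. (z *\<^sub>C p) ^ n /\<^sub>R fact n) sums (exp z *\<^sub>C p + (1 - p))"
    by simp
  hence "exp (z *\<^sub>C p) = exp z *\<^sub>C p + (1 - p)"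
    using exp_converges sums_unique2 by blast
  also have "exp z = complex_of_real (-1)"
    by (simp add: z_def mult.commute)
  also have "complex_of_real (-1) *\<^sub>C p = - p"
    by (simp only: scaleR_scaleC[symmetric]) simp
  finally have "exp (z *\<^sub>C p) = 1 - 2 * p"
    by (simp add: mult_2)
  thus ?thesis
    using assms(1) unfolding hermitian_def z_def by metis
qed

lemma bounded_powers_nilpotent:
  fixes n :: "'a::real_normed_algebra_1"
  assumes "n * n = 0" and "norm (1 + n) \<le> 1"
  shows "n = 0"
proof (rule ccontr)
  assume "n \<noteq> 0"
  have pow: "(1 + n) ^ k = 1 + of_nat k * n" for k
  proof (induction k)
    case (Suc k)
    have "n * (of_nat k * n) = of_nat k * (n * n)"
      by (metis mult.assoc mult_of_nat_commute)
    with Suc assms(1) show ?case by (simp add: algebra_simps)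
  qed simp
  have bound: "real k * norm n \<le> 2" for k
  proof -
    have "norm (1 + of_nat k * n) \<le> 1"
      unfolding pow[symmetric]
      by (rule order_trans[OF norm_power_ineq]) (simp add: assms(2) power_le_one)
    moreover have "of_nat k * n = real k *\<^sub>R n"
      by (simp add: scaleR_conv_of_real)
    ultimately have "norm (1 + real k *\<^sub>R n) \<le> 1" by simp
    moreover have "norm (real k *\<^sub>R n) \<le> norm (1 + real k *\<^sub>R n) + norm (1::'a)"
      using norm_triangle_ineq4[of "1 + real k *\<^sub>R n" 1] by simp
    ultimately show ?thesis by simp
  qed
  obtain k :: nat where "2 < real k * norm n"
    using reals_Archimedean3[of "norm n"] \<open>n \<noteq> 0\<close> by auto
  with bound[of k] show False by simp
qed

lemma hermitian_idempotents_eq: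
  fixes p q :: "'a::complex_banach_algebra_1"
  assumes "hermitian p" "hermitian q" "p * p = p" "q * q = q"
    and "(p * q = q \<and> q * p = p) \<or> (p * q = p \<and> q * p = q)"
  shows "p = q"
proof -
  have n: "norm (1 - 2 * p) = 1" "norm (1 - 2 * q) = 1"
    using assms hermitian_idempotent_norm by blast+
  have nil: "(2 * (q - p)) * (2 * (q - p)) = 0" "(2 * (p - q)) * (2 * (p - q)) = 0"
    using assms by (auto simp: algebra_simps mult_2 mult_2_right)
  have prod: "norm ((1 - 2 * p) * (1 - 2 * q)) \<le> 1"
    using norm_mult_ineq[of "1 - 2 * p" "1 - 2 * q"] n by simp
  from assms(5) show ?thesis
  proof
    assume "p * q = q \<and> q * p = p"
    hence "(1 - 2 * p) * (1 - 2 * q) = 1 + 2 * (q - p)"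
      by (simp add: algebra_simps mult_2 mult_2_right)
    with prod nil have "2 * (q - p) = 0"
      by (metis bounded_powers_nilpotent)
    moreover have "2 * (q - p) = 2 *\<^sub>R (q - p)"
      by (simp only: scaleR_2 mult_2)
    ultimately show ?thesis by simp
  next
    assume "p * q = p \<and> q * p = q"
    hence "(1 - 2 * p) * (1 - 2 * q) = 1 + 2 * (p - q)"
      by (simp add: algebra_simps mult_2 mult_2_right)
    with prod nil have "2 * (p - q) = 0"
      by (metis bounded_powers_nilpotent)
    moreover have "2 * (p - q) = 2 *\<^sub>R (p - q)"
      by (simp only: scaleR_2 mult_2)
    ultimately show ?thesis by simp
  qed
qed

lemma is_mp_inverse_unique:
  assumes "is_mp_inverse a x" "is_mp_inverse a y"
  shows "x = y"
proof -
  have x: "a * x * a = a" "x * a * x = x" "hermitian (a * x)" "hermitian (x * a)"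
    and y: "a * y * a = a" "y * a * y = y" "hermitian (a * y)" "hermitian (y * a)"
    using assms by (auto simp: is_mp_inverse_def)
  have "a * x = a * y"
    by (rule hermitian_idempotents_eq) (simp_all add: mult.assoc[symmetric] x y)
  moreover have "x * a = y * a"
    by (rule hermitian_idempotents_eq) (simp_all add: x y x(1,2)[unfolded mult.assoc] y(1,2)[unfolded mult.assoc] mult.assoc)
  ultimately show ?thesis
    using x(2) y(2) by (metis mult.assoc)
qed

lemma mp_inverse_eq: "is_mp_inverse a x \<Longrightarrow> a\<^sup>\<dagger> = x"
  unfolding mp_inverse_def using is_mp_inverse_unique by blast

end

(*
  Only the idempotency of p = aa\<^sup>\<dagger> and q = a\<^sup>\<dagger>a matters. If (p + q)x = 0, then px = -qx, so
  p(1 - q)x = 2px = -2qx lies in qA \<inter> p(1 - q)A. Conversely, if z = qz = pw with qw = 0, then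
  (p + q)w = z and (p + q)z = 2z, so invertibility gives z = 2w and z = qz = 2qw = 0.
*)
theory Submission
  imports Defs
begin

lemma left_invertible_cancel:
  fixes c x y :: "'a::monoid_mult"
  assumes "b * c = 1" and "c * x = c * y"
  shows "x = y"
proof -
  have "b * (c * x) = b * (c * y)" using assms(2) by simp
  thus ?thesis by (simp add: mult.assoc[symmetric] assms(1))
qed

text \<open>If \<open>c * b * c = c\<close>, then \<open>1 - c * b\<close> annihilates
  \<open>c\<close> from the left and \<open>1 - b * c\<close> from the right, so trivial
  annihilators turn the inner inverse \<open>b\<close> into a two-sided inverse. Regularity and the
  left annihilator occur verbatim in the theorem, which leaves only the right annihilator to be
  analysed.\<close>

lemma invertible_iff_regular_annihilators:
  "c \<in> invertible_elements \<longleftrightarrow>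
    regular c \<and> left_annihilator c = {0} \<and> right_annihilator c = {0}"
proof
  assume "c \<in> invertible_elements"
  then obtain b where b: "c * b = 1" "b * c = 1"
    by (auto simp: invertible_elements_def)
  have right: "x = 0" if "c * x = 0" for x
    using left_invertible_cancel[OF b(2), of x 0] that by simp
  have left: "x = 0" if "x * c = 0" for x
    using that b(1) by (metis mult.assoc mult.right_neutral mult_zero_left)
  have "regular c"
    unfolding regular_def by (rule exI[of _ b]) (simp add: b(1))
  moreover have "left_annihilator c = {0}" "right_annihilator c = {0}"
    unfolding left_annihilator_def right_annihilator_def
    using left right mult_zero_left[of c] mult_zero_right[of c] by blast+
  ultimately show "regular c \<and> left_annihilator c = {0} \<and> right_annihilator c = {0}"
    by blast
next
  assume h: "regular c \<and> left_annihilator c = {0} \<and> right_annihilator c = {0}"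
  then obtain b where b: "c * b * c = c"
    unfolding regular_def by metis
  have "(1 - c * b) * c = 0" "c * (1 - b * c) = 0"
    by (simp_all add: left_diff_distrib right_diff_distrib mult.assoc[symmetric] b)
  hence "1 - c * b \<in> left_annihilator c" "1 - b * c \<in> right_annihilator c"
    unfolding left_annihilator_def right_annihilator_def by (simp_all only: mem_Collect_eq)
  hence "1 - c * b = 0" "1 - b * c = 0"
    by (simp_all only: h singleton_iff)
  hence "c * b = 1" "b * c = 1"
    by simp_all
  thus "c \<in> invertible_elements"
    unfolding invertible_elements_def by blast
qed

text \<open>The last two conditions together replace triviality of
  \<open>right_annihilator (p + q)\<close>. The order, \<open>q\<close> before \<open>p\<close>,
  matches \<open>a\<close> before \<open>a\<^sup>\<dagger>\<close> in the theorem.\<close>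

lemma invertible_add_idempotents_iff:
  fixes p q :: "'a::complex_banach_algebra_1"
  assumes p: "p * p = p" and q: "q * q = q"
  shows "p + q \<in> invertible_elements \<longleftrightarrow>
    regular (p + q) \<and> left_annihilator (p + q) = {0} \<and>
    right_ideal q \<inter> right_ideal (p * (1 - q)) = {0} \<and>
    right_annihilator q \<inter> right_annihilator p = {0}"
proof -
  have pl: "p * (p * x) = p * x" and ql: "q * (q * x) = q * x" for x
    by (simp_all add: mult.assoc[symmetric] p q)
  have ideal: "z = 0"
    if inv: "p + q \<in> invertible_elements" and zq: "z \<in> right_ideal q"
      and zp: "z \<in> right_ideal (p * (1 - q))" for z
  proof -
    obtain b where b: "b * (p + q) = 1"
      using inv by (auto simp: invertible_elements_def)
    obtain y where y: "z = p * ((1 - q) * y)"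
      using zp by (auto simp: right_ideal_def mult.assoc)
    define w where "w = (1 - q) * y"
    have z: "z = p * w" and qw: "q * w = 0"
      using y by (simp_all add: w_def left_diff_distrib right_diff_distrib ql)
    have qz: "q * z = z"
      using zq by (auto simp: right_ideal_def ql)
    have pz: "p * z = z"
      by (simp add: z pl)
    \<comment> \<open>Both sides equal \<open>z + z\<close>: on the left \<open>p\<close> and
      \<open>q\<close> fix \<open>z\<close>, on the right \<open>p * w = z\<close> and
      \<open>q * w = 0\<close>.\<close>
    have "(p + q) * z = (p + q) * (w + w)"
      unfolding distrib_left distrib_right pz qz qw z[symmetric] by simp
    hence "z = w + w"
      by (rule left_invertible_cancel[OF b])
    hence "q * z = 0"
      by (simp add: distrib_left qw)
    thus "z = 0" using qz by simp
  qed
  have annihilator: "x = 0"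
    if ideals: "right_ideal q \<inter> right_ideal (p * (1 - q)) = {0}"
      and annihilators: "right_annihilator q \<inter> right_annihilator p = {0}"
      and x: "(p + q) * x = 0" for x
  proof -
    have px: "p * x = - (q * x)"
      using x by (simp add: distrib_right eq_neg_iff_add_eq_0)
    \<comment> \<open>Applying the idempotent \<open>p\<close> to \<open>px\<close> yields
      \<open>p * q * x = - (p * x)\<close>, so subtracting \<open>p * q * x\<close> from
      \<open>p * x\<close> doubles it.\<close>
    have "p * x = p * (- (q * x))"
      using pl[of x] px by simp
    hence "p * (1 - q) * x = p * x + p * x"
      by (simp add: left_diff_distrib right_diff_distrib mult.assoc)
    \<comment> \<open>The witness \<open>- x - x\<close> places the doubled element in
      \<open>right_ideal q\<close>; the witness for the other ideal is \<open>x\<close>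
      itself.\<close>
    moreover have "p * x + p * x = q * (- x - x)"
      by (simp add: px right_diff_distrib)
    ultimately have "p * x + p * x \<in> right_ideal q \<inter> right_ideal (p * (1 - q))"
      unfolding right_ideal_def by (metis (mono_tags, lifting) IntI mem_Collect_eq)
    \<comment> \<open>Written as a real multiple, the factor 2 cancels. Then
      \<open>p * x = 0\<close>, and \<open>px\<close> gives \<open>q * x = 0\<close> as
      well.\<close>
    hence "2 *\<^sub>R (p * x) = 0"
      using ideals by (simp add: scaleR_2)
    hence "x \<in> right_annihilator q \<inter> right_annihilator p"
      using px by (simp add: right_annihilator_def)
    thus "x = 0" using annihilators by blast
  qed
  have zero_ideal: "0 \<in> right_ideal c" for c :: 'a
    by (auto simp: right_ideal_def intro: exI[of _ 0])
  have zero_annihilator: "0 \<in> right_annihilator c" for c :: 'a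
    by (simp add: right_annihilator_def)
  show ?thesis
  proof
    assume inv: "p + q \<in> invertible_elements"
    hence "right_annihilator (p + q) = {0}"
      by (simp add: invertible_iff_regular_annihilators)
    moreover have "right_annihilator q \<inter> right_annihilator p \<subseteq> right_annihilator (p + q)"
      by (auto simp: right_annihilator_def distrib_right)
    ultimately have "right_annihilator q \<inter> right_annihilator p = {0}"
      using zero_annihilator[of p] zero_annihilator[of q] by auto
    moreover have "right_ideal q \<inter> right_ideal (p * (1 - q)) = {0}"
    proof (intro equalityI subsetI)
      fix z assume "z \<in> right_ideal q \<inter> right_ideal (p * (1 - q))"
      thus "z \<in> {0}" using ideal[OF inv, of z] by simp
    qed (simp add: zero_ideal)
    ultimately show "regular (p + q) \<and> left_annihilator (p + q) = {0} \<and>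
        right_ideal q \<inter> right_ideal (p * (1 - q)) = {0} \<and>
        right_annihilator q \<inter> right_annihilator p = {0}"
      using inv[unfolded invertible_iff_regular_annihilators] by (intro conjI) simp_all
  next
    assume h: "regular (p + q) \<and> left_annihilator (p + q) = {0} \<and>
        right_ideal q \<inter> right_ideal (p * (1 - q)) = {0} \<and>
        right_annihilator q \<inter> right_annihilator p = {0}"
    have "right_annihilator (p + q) = {0}"
    proof (intro equalityI subsetI)
      fix x assume "x \<in> right_annihilator (p + q)"
      hence "(p + q) * x = 0" by (simp only: right_annihilator_def mem_Collect_eq)
      with h show "x \<in> {0}" using annihilator[of x] by simp
    qed (simp add: zero_annihilator)
    thus "p + q \<in> invertible_elements"
      using h by (simp only: invertible_iff_regular_annihilators)
  qed
qed

text \<open>Multiplying \<open>x * a * y = 0\<close> by \<open>a\<close> on the left recovers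
  \<open>a * y = 0\<close>. Used for the pair \<open>a\<close>, \<open>a\<^sup>\<dagger>\<close> in
  both orders, it passes from the annihilators of the two idempotents to those of \<open>a\<close>
  and \<open>a\<^sup>\<dagger>\<close>.\<close>

lemma right_annihilator_inner_inverse_mult:
  assumes "a * x * a = a"
  shows "right_annihilator (x * a) = right_annihilator a"
proof -
  have "a * y = 0" if "x * a * y = 0" for y
    using that assms by (metis mult.assoc mult_zero_right)
  thus ?thesis
    by (auto simp: right_annihilator_def mult.assoc)
qed

theorem theorem2p5:
  fixes a :: "'a::complex_banach_algebra_1"
  assumes "mp_invertible a"
  shows "a * a\<^sup>\<dagger> + a\<^sup>\<dagger> * a \<in> invertible_elements \<longleftrightarrow>
    regular (a * a\<^sup>\<dagger> + a\<^sup>\<dagger> * a) \<and>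
    left_annihilator (a * a\<^sup>\<dagger> + a\<^sup>\<dagger> * a) = {0} \<and>
    right_ideal (a\<^sup>\<dagger> * a) \<inter> right_ideal (a * a\<^sup>\<dagger> * (1 - a\<^sup>\<dagger> * a)) = {0} \<and>
    right_annihilator a \<inter> right_annihilator (a\<^sup>\<dagger>) = {0}"
proof -
  obtain x where "is_mp_inverse a x"
    using assms by (auto simp: mp_invertible_def)
  \<comment> \<open>Uniqueness of the Moore-Penrose inverse identifies the definite description
    \<open>a\<^sup>\<dagger>\<close> with the witness \<open>x\<close>.\<close>
  hence "is_mp_inverse a (a\<^sup>\<dagger>)"
    by (simp add: mp_inverse_eq)
  hence mp: "a * a\<^sup>\<dagger> * a = a" "a\<^sup>\<dagger> * a * a\<^sup>\<dagger> = a\<^sup>\<dagger>"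
    by (simp_all add: is_mp_inverse_def)
  have "(a * a\<^sup>\<dagger>) * (a * a\<^sup>\<dagger>) = a * a\<^sup>\<dagger>" "(a\<^sup>\<dagger> * a) * (a\<^sup>\<dagger> * a) = a\<^sup>\<dagger> * a"
    by (simp_all add: mult.assoc[symmetric] mp)
  from invertible_add_idempotents_iff[OF this] show ?thesis
    by (simp only: right_annihilator_inner_inverse_mult mp)
qed

end
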